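(* Let $n>2$ and $m>2$ be two integers and let $t\geq 1$ be an integer such that $2^t<n\leq 2^{t+1}$. Then the ring $\mathbb{T}_n(\mathbb{F}_2)$ is $m$-torsion clean if and only if $m=2^{t+1}$.
   Context: $\mathbb{F}_2$ is the field with two elements and $\mathbb{T}_n(\mathbb{F}_2)$ is the ring of all upper triangular $n\times n$ matrices over $\mathbb{F}_2$. For a positive integer $m$, a ring $R$ with identity $1\neq 0$ is called almost $m$-torsion clean if for every $r\in R$ there exist a unit $u\in R$ with $u^m=1$ and an idempotent $e\in R$ (i.e. $e^2=e$) such that $r=u+e$. The ring $R$ is called $m$-torsion clean if it is almost $m$-torsion clean and $m$ is the smallest positive integer with this property (i.e. $R$ is not almost $m'$-torsion clean for any positive integer $m'<m$). *)

theory Defs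
  imports
    "HOL-Algebra.Ring"
    "HOL-Library.Z2"
    "Jordan_Normal_Form.Matrix"
begin

definition almost_torsion_clean :: "nat \<Rightarrow> ('a, 'b) ring_scheme \<Rightarrow> bool" where
  "almost_torsion_clean m R \<longleftrightarrow>
     0 < m \<and> ring R \<and> \<one>\<^bsub>R\<^esub> \<noteq> \<zero>\<^bsub>R\<^esub> \<and>
     (\<forall>r \<in> carrier R. \<exists>u \<in> Units R. \<exists>e \<in> carrier R.
        u [^]\<^bsub>R\<^esub> m = \<one>\<^bsub>R\<^esub> \<and> e \<otimes>\<^bsub>R\<^esub> e = e \<and> r = u \<oplus>\<^bsub>R\<^esub> e)"

definition torsion_clean :: "nat \<Rightarrow> ('a, 'b) ring_scheme \<Rightarrow> bool" where
  "torsion_clean m R \<longleftrightarrow>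
     almost_torsion_clean m R \<and> (\<forall>m'. 0 < m' \<and> m' < m \<longrightarrow> \<not> almost_torsion_clean m' R)"

definition upper_triangular_ring :: "'a::comm_ring_1 itself \<Rightarrow> nat \<Rightarrow> 'a mat ring" where
  "upper_triangular_ring ty n =
     (ring_mat ty n ()) \<lparr>carrier := {A \<in> carrier_mat n n. upper_triangular A}\<rparr>"

text \<open>The field with two elements is the type \<open>bit\<close> of \<open>HOL-Library.Z2\<close>.\<close>

abbreviation T2 :: "nat \<Rightarrow> bit mat ring" where
  "T2 n \<equiv> upper_triangular_ring TYPE(bit) n"

end

theory Submission
  imports
    Defs
    "HOL-Algebra.Subrings"
    "Jordan_Normal_Form.Jordan_Normal_Form"
begin

text \<open>The units of the ring are the unitriangular matrices $1 + N$ with $N$ strictly upper triangular,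
since over the field with two elements an invertible diagonal entry is $1$.  In characteristic two
$(1 + N)^{2^s} = 1 + N^{2^s}$, and $N^n = 0$, so every unit satisfies $u^{2^s} = 1$ as soon as
$n \le 2^s$.  Every matrix $r$ is the sum of a unit and an idempotent: the diagonal matrix $e$ with
entries $r_{ii} + 1$ is idempotent because its entries are $0$ or $1$, and $r - e$ is unitriangular.
This gives \<open>almost_torsion_clean_two_power\<close>.

For the lower bound, let $r$ be the Jordan block with eigenvalue $1$.  In a decomposition
$r = u + e$ both $r$ and $u$ have diagonal $1$, so $e$ is strictly upper triangular, hence nilpotent,
and a nilpotent idempotent is $0$.  Thus $r = u$, and every admissible exponent is a multiple of the
order of $r$.  That order is a power of two, and $r^{2^t} \neq 1$ when $2^t < n$, because $r^{2^t}$
has the binomial coefficient $\binom{2^t}{2^t} = 1$ in position $(0, 2^t)$.  Hence $2^{t+1}$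
divides every admissible exponent (\<open>almost_torsion_clean_imp_two_power_dvd\<close>).  When
$2^t < n \le 2^{t+1}$ the two bounds meet.\<close>

section \<open>Matrices vanishing below a superdiagonal\<close>

text \<open>The filtration of the upper triangular matrices by superdiagonals: level $0$ is upper triangular,
level $1$ strictly upper triangular.  It is multiplicative, so that one product lemma yields both
closure of the upper triangular matrices under products and nilpotency of the strict ones.\<close>

definition vanishes_below :: "nat \<Rightarrow> 'a::zero mat \<Rightarrow> bool" where
  "vanishes_below k A \<longleftrightarrow>
     (\<forall>i < dim_row A. \<forall>j < dim_col A. j < i + k \<longrightarrow> A $$ (i, j) = 0)"

lemma upper_triangular_iff_vanishes_below:
  assumes "A \<in> carrier_mat n n"
  shows "upper_triangular A \<longleftrightarrow> vanishes_below 0 A"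
  using assms unfolding upper_triangular_def vanishes_below_def by auto

lemma index_mult_mat_sum:
  assumes "A \<in> carrier_mat n n" "B \<in> carrier_mat n n" "i < n" "j < n"
  shows "(A * B) $$ (i, j) = (\<Sum>l<n. A $$ (i, l) * B $$ (l, j))"
  using assms by (auto simp: scalar_prod_def atLeast0LessThan intro!: sum.cong)

text \<open>If $j < i + k + l$, then every intermediate index $p$ satisfies $p < i + k$ or $j < p + l$, so one
factor of each summand $A_{ip} B_{pj}$ is zero.\<close>

lemma vanishes_below_mult:
  fixes A B :: "'a::comm_ring_1 mat"
  assumes A: "A \<in> carrier_mat n n" and B: "B \<in> carrier_mat n n"
    and "vanishes_below k A" "vanishes_below l B"
  shows "vanishes_below (k + l) (A * B)"
proof -
  have "(A * B) $$ (i, j) = 0" if ij: "i < n" "j < n" "j < i + (k + l)" for i j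
  proof -
    have "A $$ (i, p) * B $$ (p, j) = 0" if "p < n" for p
    proof (cases "p < i + k")
      case True
      then show ?thesis using assms ij that unfolding vanishes_below_def by auto
    next
      case False
      then have "j < p + l" using ij by simp
      then show ?thesis using assms ij that unfolding vanishes_below_def by auto
    qed
    then show ?thesis using index_mult_mat_sum[OF A B ij(1,2)] by simp
  qed
  then show ?thesis using A B unfolding vanishes_below_def by auto
qed

lemma strictly_upper_triangular_nilpotent:
  fixes A :: "'a::comm_ring_1 mat"
  assumes A: "A \<in> carrier_mat n n" and "vanishes_below 1 A" and "n \<le> k"
  shows "A ^\<^sub>m k = 0\<^sub>m n n"
proof -
  have "vanishes_below k (A ^\<^sub>m k)"
  proof (induction k)
    case 0
    then show ?case by (auto simp: vanishes_below_def)
  next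
    case (Suc k)
    then show ?case
      using vanishes_below_mult[OF pow_carrier_mat[OF A] A Suc assms(2)] by simp
  qed
  then show ?thesis
    using A \<open>n \<le> k\<close> by (intro eq_matI) (auto simp: vanishes_below_def)
qed

text \<open>In $\sum_l A_{il} B_{li}$ the terms with $l < i$ vanish because of $A$, those with $l > i$ because
of $B$.  Taking a diagonal entry is therefore multiplicative on upper triangular matrices.\<close>

lemma upper_triangular_mult_diagonal:
  fixes A B :: "'a::comm_ring_1 mat"
  assumes A: "A \<in> carrier_mat n n" "upper_triangular A"
    and B: "B \<in> carrier_mat n n" "upper_triangular B" and i: "i < n"
  shows "(A * B) $$ (i, i) = A $$ (i, i) * B $$ (i, i)"
proof -
  have "A $$ (i, l) * B $$ (l, i) = 0" if "l < n" "l \<noteq> i" for l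
    using that assms by (cases "l < i") (auto simp: upper_triangular_def)
  then have "(\<Sum>l<n. A $$ (i, l) * B $$ (l, i))
      = (\<Sum>l<n. if l = i then A $$ (i, i) * B $$ (i, i) else 0)"
    by (intro sum.cong) auto
  then show ?thesis using index_mult_mat_sum[OF A(1) B(1) i i] i by simp
qed

section \<open>The ring of upper triangular matrices\<close>

lemma upper_triangular_ring_simps:
  "carrier (upper_triangular_ring TYPE('a::comm_ring_1) n)
     = {A \<in> carrier_mat n n. upper_triangular A}"
  "mult (upper_triangular_ring TYPE('a) n) = (*)"
  "add (upper_triangular_ring TYPE('a) n) = (+)"
  "one (upper_triangular_ring TYPE('a) n) = 1\<^sub>m n"
  "zero (upper_triangular_ring TYPE('a) n) = 0\<^sub>m n n"
  by (simp_all add: upper_triangular_ring_def ring_mat_def)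

lemma ring_upper_triangular_ring: "ring (upper_triangular_ring TYPE('a::comm_ring_1) n)"
proof -
  let ?M = "ring_mat TYPE('a) n ()"
  interpret M: ring ?M by (rule ring_mat)
  have "subring {A \<in> carrier_mat n n. upper_triangular A} ?M"
  proof (rule M.subringI)
    fix A :: "'a mat" assume A: "A \<in> {A \<in> carrier_mat n n. upper_triangular A}"
    then have "\<ominus>\<^bsub>?M\<^esub> A = - A"
      by (intro M.minus_equality) (auto simp: ring_mat_def)
    then show "\<ominus>\<^bsub>?M\<^esub> A \<in> {A \<in> carrier_mat n n. upper_triangular A}"
      using A by (auto simp: upper_triangular_def)
  next
    fix A B :: "'a mat"
    assume A: "A \<in> {A \<in> carrier_mat n n. upper_triangular A}"
      and B: "B \<in> {A \<in> carrier_mat n n. upper_triangular A}"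
    then show "A \<oplus>\<^bsub>?M\<^esub> B \<in> {A \<in> carrier_mat n n. upper_triangular A}"
      by (auto simp: ring_mat_simps upper_triangular_def)
    have "vanishes_below (0 + 0) (A * B)"
      using A B by (intro vanishes_below_mult) (auto simp: upper_triangular_iff_vanishes_below)
    then show "A \<otimes>\<^bsub>?M\<^esub> B \<in> {A \<in> carrier_mat n n. upper_triangular A}"
      using A B by (auto simp: ring_mat_simps upper_triangular_iff_vanishes_below[of _ n])
  qed (auto simp: ring_mat_simps)
  then show ?thesis
    unfolding upper_triangular_ring_def by (rule M.subring_is_ring)
qed

text \<open>Passes between abstract ring powers, for which the Frobenius argument is carried out, and
matrix powers, for which nilpotency and the formula for Jordan blocks are available.\<close>

lemma nat_pow_upper_triangular_ring:
  assumes "A \<in> carrier (upper_triangular_ring TYPE('a::comm_ring_1) n)"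
  shows "A [^]\<^bsub>upper_triangular_ring TYPE('a) n\<^esub> (k::nat) = A ^\<^sub>m k"
proof -
  interpret R: ring "upper_triangular_ring TYPE('a) n" by (rule ring_upper_triangular_ring)
  show ?thesis
    using assms by (induction k) (auto simp: upper_triangular_ring_simps)
qed

section \<open>Powers of unipotent elements in characteristic two\<close>

text \<open>Repeated squaring: in $(1 + y)^2 = 1 + (y + y) + y^2$ the middle term vanishes in characteristic two.\<close>

lemma (in ring) one_plus_pow_two_power:
  assumes "\<one> \<oplus> \<one> = \<zero>" and x: "x \<in> carrier R"
  shows "(\<one> \<oplus> x) [^] (2 ^ s :: nat) = \<one> \<oplus> x [^] (2 ^ s :: nat)"
proof (induction s)
  case 0
  then show ?case using x by simp
next
  case (Suc s)
  let ?y = "x [^] (2 ^ s :: nat)"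
  have y: "?y \<in> carrier R" using x by simp
  have yy: "?y \<oplus> ?y = \<zero>"
    using l_distr[of \<one> \<one> ?y] assms(1) y by simp
  have sq: "z [^] (2 ^ Suc s :: nat) = z [^] (2 ^ s :: nat) \<otimes> z [^] (2 ^ s :: nat)"
    if "z \<in> carrier R" for z
    using that by (simp add: nat_pow_mult mult_2)
  have "(\<one> \<oplus> ?y) \<otimes> (\<one> \<oplus> ?y) = \<one> \<oplus> (?y \<oplus> ?y) \<oplus> ?y \<otimes> ?y"
    using y by (simp add: l_distr r_distr a_ac)
  also have "\<dots> = \<one> \<oplus> ?y \<otimes> ?y" using y yy by simp
  finally show ?case using x by (simp only: sq Suc add.m_closed one_closed)
qed

lemma (in monoid) pow_gcd_eq_one:
  fixes a b :: nat
  assumes x: "x \<in> carrier G" and "x [^] a = \<one>" and "x [^] b = \<one>"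
  shows "x [^] gcd a b = \<one>"
proof (cases "a = 0")
  case True
  then show ?thesis using assms by simp
next
  case False
  then obtain p q where pq: "a * p = b * q + gcd a b" using bezout_nat by blast
  have "x [^] (a * p) = \<one>" "x [^] (b * q) = \<one>"
    using assms by (simp_all add: nat_pow_pow[symmetric])
  then show ?thesis using pq x by (metis l_one nat_pow_closed nat_pow_mult)
qed

text \<open>Write $U = 1 + N$, where $N = 1 + U$ because $-1 = 1$.  Then $N$ is strictly upper triangular and
$U^{2^s} = 1 + N^{2^s} = 1$.\<close>

lemma unipotent_pow_two_power:
  assumes U: "U \<in> carrier (T2 n)" and diag: "\<And>i. i < n \<Longrightarrow> U $$ (i, i) = 1"
    and n: "n \<le> 2 ^ s"
  shows "U [^]\<^bsub>T2 n\<^esub> (2 ^ s :: nat) = \<one>\<^bsub>T2 n\<^esub>"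
proof -
  interpret R: ring "T2 n" by (rule ring_upper_triangular_ring)
  define N where "N = \<one>\<^bsub>T2 n\<^esub> \<oplus>\<^bsub>T2 n\<^esub> U"
  have N: "N \<in> carrier (T2 n)" using U by (simp add: N_def)
  have two: "\<one>\<^bsub>T2 n\<^esub> \<oplus>\<^bsub>T2 n\<^esub> \<one>\<^bsub>T2 n\<^esub> = \<zero>\<^bsub>T2 n\<^esub>"
    by (auto simp: upper_triangular_ring_simps intro!: eq_matI)
  have "vanishes_below 1 N"
    using U diag
    by (auto simp: N_def upper_triangular_ring_simps vanishes_below_def upper_triangular_def less_Suc_eq)
  then have "N [^]\<^bsub>T2 n\<^esub> (2 ^ s :: nat) = \<zero>\<^bsub>T2 n\<^esub>"
    using N n strictly_upper_triangular_nilpotent[of N n "2 ^ s"]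
    by (simp add: nat_pow_upper_triangular_ring[OF N]) (simp add: upper_triangular_ring_simps)
  moreover have "\<one>\<^bsub>T2 n\<^esub> \<oplus>\<^bsub>T2 n\<^esub> N = U"
    using two U R.a_assoc[of "\<one>\<^bsub>T2 n\<^esub>" "\<one>\<^bsub>T2 n\<^esub>" U] by (simp add: N_def)
  ultimately show ?thesis
    using R.one_plus_pow_two_power[OF two N, of s] by simp
qed

section \<open>The exponents for which the ring is almost torsion clean\<close>

text \<open>Subtracting a diagonal idempotent changes only the diagonal, and over the field with two elements
the idempotent can be chosen to turn every diagonal entry into $1$, whatever the matrix.\<close>

lemma almost_torsion_clean_two_power:
  assumes "0 < n" and n: "n \<le> 2 ^ s"
  shows "almost_torsion_clean (2 ^ s) (T2 n)"
proof -
  interpret R: ring "T2 n" by (rule ring_upper_triangular_ring)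
  have "\<one>\<^bsub>T2 n\<^esub> $$ (0, 0) \<noteq> \<zero>\<^bsub>T2 n\<^esub> $$ (0, 0)"
    using \<open>0 < n\<close> by (simp add: upper_triangular_ring_simps)
  then have nontrivial: "\<one>\<^bsub>T2 n\<^esub> \<noteq> \<zero>\<^bsub>T2 n\<^esub>" by metis
  have "\<exists>u \<in> Units (T2 n). \<exists>e \<in> carrier (T2 n). u [^]\<^bsub>T2 n\<^esub> (2 ^ s :: nat) = \<one>\<^bsub>T2 n\<^esub> \<and>
      e \<otimes>\<^bsub>T2 n\<^esub> e = e \<and> r = u \<oplus>\<^bsub>T2 n\<^esub> e"
    if r: "r \<in> carrier (T2 n)" for r
  proof -
    define e where "e = mat n n (\<lambda>(i, j). if i = j then r $$ (i, i) + 1 else 0)"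
    have e: "e \<in> carrier (T2 n)" by (auto simp: e_def upper_triangular_ring_simps)
    have idem: "e * e = e"
    proof (intro eq_matI)
      fix i j assume "i < dim_row e" "j < dim_col e"
      then have ij: "i < n" "j < n" by (auto simp: e_def)
      have bit: "b * b = b" for b :: bit by (cases b) auto
      have "(e * e) $$ (i, j) = (\<Sum>l<n. e $$ (i, l) * e $$ (l, j))"
        using e ij by (intro index_mult_mat_sum) (auto simp: upper_triangular_ring_simps)
      also have "\<dots> = (\<Sum>l<n. if l = i then e $$ (i, j) else 0)"
        using ij bit by (intro sum.cong) (auto simp: e_def)
      finally show "(e * e) $$ (i, j) = e $$ (i, j)" using ij by simp
    qed (auto simp: e_def)
    \<comment> \<open>In characteristic two \<open>r + e\<close> is \<open>r - e\<close>.\<close>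
    define u where "u = r + e"
    have u: "u \<in> carrier (T2 n)" using R.a_closed[OF r e]
      by (simp add: u_def upper_triangular_ring_simps)
    have upow: "u [^]\<^bsub>T2 n\<^esub> (2 ^ s :: nat) = \<one>\<^bsub>T2 n\<^esub>"
      using u _ n
    proof (rule unipotent_pow_two_power)
      show "u $$ (i, i) = 1" if "i < n" for i
        using that by (cases "r $$ (i, i)") (auto simp: u_def e_def)
    qed
    \<comment> \<open>The preceding power of \<open>u\<close> is the inverse of \<open>u\<close>.\<close>
    obtain p where p: "2 ^ s = Suc p" using not0_implies_Suc[of "2 ^ s"] by auto
    have "u [^]\<^bsub>T2 n\<^esub> p \<otimes>\<^bsub>T2 n\<^esub> u = \<one>\<^bsub>T2 n\<^esub>" "u \<otimes>\<^bsub>T2 n\<^esub> u [^]\<^bsub>T2 n\<^esub> p = \<one>\<^bsub>T2 n\<^esub>"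
      using upow R.nat_pow_Suc2[OF u, of p] unfolding p by simp_all
    then have unit: "u \<in> Units (T2 n)"
      using u R.nat_pow_closed[OF u] unfolding Units_def by blast
    have "r = u + e"
      using r by (intro eq_matI) (auto simp: u_def e_def upper_triangular_ring_simps)
    then show ?thesis
      using unit e upow idem by (auto simp: upper_triangular_ring_simps)
  qed
  then show ?thesis
    using nontrivial R.ring_axioms unfolding almost_torsion_clean_def by simp
qed

lemma unit_diagonal:
  assumes U: "U \<in> Units (T2 n)" and i: "i < n"
  shows "U $$ (i, i) = 1"
proof -
  obtain V where "V \<in> carrier (T2 n)" "V * U = 1\<^sub>m n"
    using U by (auto simp: Units_def upper_triangular_ring_simps)
  then have "V $$ (i, i) * U $$ (i, i) = 1"
    using upper_triangular_mult_diagonal[of V n U i] U i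
    by (auto simp: Units_def upper_triangular_ring_simps)
  then show ?thesis by (cases "U $$ (i, i)") auto
qed

text \<open>Diagonals force $E$ to be strictly upper triangular; being both nilpotent and idempotent, it is $0$.\<close>

lemma unipotent_decomposition_trivial:
  assumes U: "U \<in> Units (T2 n)" and E: "E \<in> carrier (T2 n)" and idem: "E * E = E"
    and diag: "\<And>i. i < n \<Longrightarrow> (U + E) $$ (i, i) = 1"
  shows "E = 0\<^sub>m n n"
proof -
  have E': "E \<in> carrier_mat n n" "upper_triangular E"
    using E by (auto simp: upper_triangular_ring_simps)
  have "E $$ (i, i) = 0" if "i < n" for i
    using diag[OF that] unit_diagonal[OF U that] E' that by simp
  then have "vanishes_below 1 E"
    using E' by (auto simp: vanishes_below_def upper_triangular_def less_Suc_eq)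
  then have "E ^\<^sub>m Suc n = 0\<^sub>m n n"
    using E' by (intro strictly_upper_triangular_nilpotent) auto
  \<comment> \<open>Positive exponents only: the zeroth power is \<open>1\<close>, whatever \<open>E\<close> is; hence \<open>Suc n\<close> above.\<close>
  moreover have "E ^\<^sub>m Suc k = E" for k
    using E' idem by (induction k) auto
  ultimately show ?thesis by metis
qed

text \<open>The Jordan block is its own unit part in any decomposition, so $m$ is a multiple of its order.\<close>

lemma almost_torsion_clean_imp_two_power_dvd:
  assumes clean: "almost_torsion_clean m (T2 n)" and t: "2 ^ t < n"
  shows "2 ^ (t + 1) dvd m"
proof -
  interpret R: ring "T2 n" by (rule ring_upper_triangular_ring)
  let ?J = "jordan_block n (1::bit)"
  have J: "?J \<in> carrier (T2 n)" by (auto simp: upper_triangular_ring_simps)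
  obtain u e where ue0: "u \<in> Units (T2 n)" "e \<in> carrier (T2 n)"
      "u [^]\<^bsub>T2 n\<^esub> m = \<one>\<^bsub>T2 n\<^esub>" "e \<otimes>\<^bsub>T2 n\<^esub> e = e" "?J = u \<oplus>\<^bsub>T2 n\<^esub> e"
    using clean J unfolding almost_torsion_clean_def by blast
  note ue = ue0(1-3) ue0(4,5)[unfolded upper_triangular_ring_simps]
  have "e = 0\<^sub>m n n"
    using ue(1,2,4) by (rule unipotent_decomposition_trivial) (simp flip: ue(5))
  then have "?J = u"
    using ue(1,5) by (auto simp: Units_def upper_triangular_ring_simps)
  then have Jm: "?J [^]\<^bsub>T2 n\<^esub> m = \<one>\<^bsub>T2 n\<^esub>" using ue(3) by simp
  \<comment> \<open>Any power of two that is at least \<open>n\<close> serves here; it only has to show that the order is a power of two.\<close>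
  have "?J [^]\<^bsub>T2 n\<^esub> (2 ^ n :: nat) = \<one>\<^bsub>T2 n\<^esub>"
    by (rule unipotent_pow_two_power[OF J]) auto
  with Jm have Jgcd: "?J [^]\<^bsub>T2 n\<^esub> gcd m (2 ^ n) = \<one>\<^bsub>T2 n\<^esub>"
    by (rule R.pow_gcd_eq_one[OF J])
  obtain j where j: "gcd m (2 ^ n) = 2 ^ j"
    using divides_primepow_nat[of 2 "gcd m (2 ^ n)" n] by auto
  have "t < j"
  proof (rule ccontr)
    assume "\<not> t < j"
    then have dvd: "(2::nat) ^ t = 2 ^ j * 2 ^ (t - j)" by (simp flip: power_add)
    have "?J [^]\<^bsub>T2 n\<^esub> (2 ^ t :: nat) = \<one>\<^bsub>T2 n\<^esub>"
      unfolding dvd using Jgcd j J by (simp flip: R.nat_pow_pow)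
    then have eq: "?J ^\<^sub>m (2 ^ t) = 1\<^sub>m n"
      by (simp add: nat_pow_upper_triangular_ring[OF J]) (simp add: upper_triangular_ring_simps)
    \<comment> \<open>Column \<open>2 ^ t\<close> exists because \<open>2 ^ t < n\<close>; off the diagonal, the identity has entry \<open>0\<close>.\<close>
    have "(?J ^\<^sub>m (2 ^ t)) $$ (0, 2 ^ t) = 1"
      using t by (simp add: jordan_block_pow)
    then show False unfolding eq using t by simp
  qed
  then have "2 ^ (t + 1) dvd gcd m (2 ^ n)" unfolding j by (intro le_imp_power_dvd) simp
  then show ?thesis by simp
qed

theorem theorem2p15:
  fixes n m t :: nat
  assumes "n > 2" and "m > 2" and "t \<ge> 1"
    and "2 ^ t < n" and "n \<le> 2 ^ (t + 1)"
  shows "torsion_clean m (T2 n) \<longleftrightarrow> m = 2 ^ (t + 1)"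
proof -
  have clean: "almost_torsion_clean (2 ^ (t + 1)) (T2 n)"
    using assms by (intro almost_torsion_clean_two_power) auto
  have least: "2 ^ (t + 1) \<le> k" if "almost_torsion_clean k (T2 n)" for k
    using almost_torsion_clean_imp_two_power_dvd[OF that assms(4)] that
    by (intro dvd_imp_le) (auto simp: almost_torsion_clean_def)
  show ?thesis
  proof
    assume m: "torsion_clean m (T2 n)"
    then have "\<not> 2 ^ (t + 1) < m"
      using clean unfolding torsion_clean_def by auto
    then show "m = 2 ^ (t + 1)"
      using least m unfolding torsion_clean_def by (meson le_antisym not_le)
  next
    assume "m = 2 ^ (t + 1)"
    then show "torsion_clean m (T2 n)"
      using clean least unfolding torsion_clean_def by (meson not_le)
  qed
qed

end
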